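(* Let $H$ be a $3$-uniform hypergraph in which every pair of (distinct) vertices lie together in at least two edges. Then $H$ is eulerian.
   Context: A hypergraph $H=(V,E)$ has a non-empty finite vertex set $V$ and a finite collection $E$ of edges, each associated with a subset of $V$; parallel edges (distinct edges with the same vertex set) are allowed, so $E$ is a multiset of subsets of $V$ and edges are counted with multiplicity. $H$ is $3$-uniform if every edge has exactly $3$ vertices. A walk is a sequence $v_0e_1v_1\dots v_{k-1}e_kv_k$ ($k\ge 0$) of vertices $v_i$ and edges $e_i$ such that $v_{i-1}\neq v_i$ and $v_{i-1},v_i\in e_i$ for all $i=1,\dots,k$; it is closed if $v_0=v_k$. It is a strict trail if $e_1,\dots,e_k$ are pairwise distinct edges. An Euler tour of $H$ is a closed strict trail traversing every edge of $H$ exactly once (if $H$ has no edges, any trivial walk, i.e. one with $k=0$, is an Euler tour). $H$ is eulerian if it admits an Euler tour. *)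

theory Defs
  imports Main
begin

text \<open>
  Parallel edges are distinct elements of \<open>edges H\<close> with the same value under \<open>ends H\<close>,
  so the multiset of edges is the family of the sets \<open>ends H e\<close> for \<open>e \<in> edges H\<close>.
\<close>

record ('v, 'e) pre_hypergraph =
  verts :: "'v set"
  edges :: "'e set"
  ends :: "'e \<Rightarrow> 'v set"

locale hypergraph =
  fixes H :: "('v, 'e) pre_hypergraph"
  assumes finite_verts: "finite (verts H)"
    and verts_nonempty: "verts H \<noteq> {}"
    and finite_edges: "finite (edges H)"
    and ends_subset: "\<And>e. e \<in> edges H \<Longrightarrow> ends H e \<subseteq> verts H"

definition uniform :: "nat \<Rightarrow> ('v, 'e) pre_hypergraph \<Rightarrow> bool" where
  "uniform r H \<longleftrightarrow> (\<forall>e\<in>edges H. card (ends H e) = r)"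

text \<open>
  The walk \<open>v\<^sub>0 e\<^sub>1 v\<^sub>1 \<dots> e\<^sub>k v\<^sub>k\<close> is given by its vertex list (of length \<open>k + 1\<close>)
  and its edge list (of length \<open>k\<close>); the edge \<open>e\<^sub>i\<close> is the entry \<open>i - 1\<close> of the latter.
\<close>

definition walk :: "('v, 'e) pre_hypergraph \<Rightarrow> 'v list \<Rightarrow> 'e list \<Rightarrow> bool" where
  "walk H vs es \<longleftrightarrow>
     length vs = Suc (length es) \<and> set vs \<subseteq> verts H \<and> set es \<subseteq> edges H \<and>
     (\<forall>i<length es. vs ! i \<noteq> vs ! Suc i \<and>
        vs ! i \<in> ends H (es ! i) \<and> vs ! Suc i \<in> ends H (es ! i))"

definition closed_walk :: "('v, 'e) pre_hypergraph \<Rightarrow> 'v list \<Rightarrow> 'e list \<Rightarrow> bool" where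
  "closed_walk H vs es \<longleftrightarrow> walk H vs es \<and> hd vs = last vs"

definition strict_trail :: "('v, 'e) pre_hypergraph \<Rightarrow> 'v list \<Rightarrow> 'e list \<Rightarrow> bool" where
  "strict_trail H vs es \<longleftrightarrow> walk H vs es \<and> distinct es"

definition euler_tour :: "('v, 'e) pre_hypergraph \<Rightarrow> 'v list \<Rightarrow> 'e list \<Rightarrow> bool" where
  "euler_tour H vs es \<longleftrightarrow> closed_walk H vs es \<and> strict_trail H vs es \<and> set es = edges H"

definition eulerian :: "('v, 'e) pre_hypergraph \<Rightarrow> bool" where
  "eulerian H \<longleftrightarrow> (\<exists>vs es. euler_tour H vs es)"

end

theory Submission imports Defs begin

text \<open>
  An Euler tour uses each edge to pass between two of its three vertices. Conversely, choose in
  every edge \<open>e\<close> a pair \<open>f e\<close> of its vertices; if the multigraph with these pairs as edges has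
  all degrees even and all its edges in one component, then Euler's theorem for multigraphs
  (\<open>multigraph_euler\<close>) turns it into an Euler tour of the hypergraph. So everything is about
  finding a good choice of pairs.

  Even degrees (\<open>exists_even_choice\<close>). Fix a vertex \<open>r\<close>. The edges through \<open>r\<close> form, after
  removal of \<open>r\<close>, a multigraph on the other vertices, and the hypothesis says that its minimum
  degree is at least two. Hence distinct incident edges \<open>m x\<close> can be assigned to all vertices
  \<open>x \<noteq> r\<close> (\<open>distinct_incident_edges\<close>). In the edge \<open>m x = {r, x, y}\<close> the pairs
  \<open>{x, y}\<close> and \<open>{r, y}\<close> differ only in their effect on the degrees of \<open>x\<close> and \<open>r\<close>, so the parities
  at all \<open>x \<noteq> r\<close> can be corrected independently, and the parity at \<open>r\<close> is then right by the
  handshake lemma.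

  Connectedness (\<open>exists_linked_even_choice\<close>). Among all even choices \<open>f\<close> and all connected vertex
  sets \<open>S\<close> of their multigraphs take a pair with \<open>S\<close> largest. Suppose that some chosen pair avoids
  \<open>S\<close>, and let \<open>v\<close> be one of its vertices. Let \<open>u \<in> S\<close> be a vertex such that \<open>S - {u}\<close> is still
  connected. Two edges contain both \<open>u\<close> and \<open>v\<close>; the pair chosen in either of them contains exactly
  one of \<open>u\<close> and \<open>v\<close>, and exchanging \<open>u\<close> with \<open>v\<close> in both pairs keeps all degrees even. In each
  case this exchange produces a connected set larger than \<open>S\<close>.
\<close>

section \<open>Multigraphs with minimum degree two\<close>

lemma card_2_other:
  assumes "card X = 2" "x \<in> X"
  obtains y where "y \<noteq> x" "X = {x, y}"
proof -
  have "card (X - {x}) = 1" using assms by (simp add: card_Diff_singleton)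
  then obtain y where "X - {x} = {y}" using card_1_singletonE by blast
  then have "y \<noteq> x" "X = {x, y}" using \<open>x \<in> X\<close> by auto
  then show thesis using that by blast
qed

text \<open>
  The assignment is built along a walk: \<open>U\<close> is the set of vertices that have received an edge, all
  these edges run inside \<open>insert t U\<close>, and at most one of them, the edge \<open>e0\<close> by which the walk has
  arrived, touches the current vertex \<open>t\<close>. Since \<open>t\<close> has a second edge, that edge is still free and
  is given to \<open>t\<close>. If it leads to a new vertex, the walk goes on there; if it leads back into \<open>U\<close>,
  a new walk starts at any remaining vertex.
\<close>

lemma distinct_incident_edges:
  fixes g :: "'e \<Rightarrow> 'v set"
  assumes "finite W"
    and pairs: "\<And>e. e \<in> L \<Longrightarrow> card (g e) = 2 \<and> g e \<subseteq> W"
    and deg: "\<And>x. x \<in> W \<Longrightarrow> card {e \<in> L. x \<in> g e} \<ge> 2"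
  shows "\<exists>m. inj_on m W \<and> (\<forall>x\<in>W. m x \<in> L \<and> x \<in> g (m x))"
proof -
  have walk_on: "\<exists>m. inj_on m W \<and> (\<forall>x\<in>W. m x \<in> L \<and> x \<in> g (m x))"
    if "U \<subseteq> W" "t \<in> W - U" "inj_on m U"
      "\<forall>x\<in>U. m x \<in> L \<and> x \<in> g (m x) \<and> g (m x) \<subseteq> insert t U"
      "\<forall>x\<in>U. t \<in> g (m x) \<longrightarrow> m x = e0"
    for U t and m :: "'v \<Rightarrow> 'e" and e0
    using that
  proof (induction "card (W - U)" arbitrary: U t m e0 rule: less_induct)
    case less
    have "\<not> {e \<in> L. t \<in> g e} \<subseteq> {e0}"
    proof
      assume "{e \<in> L. t \<in> g e} \<subseteq> {e0}"
      then have "card {e \<in> L. t \<in> g e} \<le> card {e0}" by (intro card_mono) auto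
      with deg[of t] less.prems(2) show False by simp
    qed
    then obtain e where e: "e \<in> L" "t \<in> g e" "e \<noteq> e0" by auto
    obtain y where y: "y \<noteq> t" "g e = {t, y}"
      using card_2_other pairs e by metis
    define U' where "U' = insert t U"
    define m' where "m' = m(t := e)"
    have "e \<notin> m ` U" using less.prems(5) e by auto
    then have inj: "inj_on m' U'"
      using less.prems(2,3) unfolding m'_def U'_def by (auto simp: inj_on_def)
    have inc: "\<forall>x\<in>U'. m' x \<in> L \<and> x \<in> g (m' x) \<and> g (m' x) \<subseteq> insert y U'"
      using less.prems(2,4) e y unfolding m'_def U'_def by auto
    show ?case
    proof (cases "U' = W")
      case True
      then show ?thesis using inj inc by blast
    next
      case False
      have U': "U' \<subseteq> W" using less.prems(1,2) unfolding U'_def by auto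
      have "y \<in> W" using pairs[OF e(1)] y by auto
      with False U' obtain t' where t': "t' \<in> W - U'" "y \<notin> U' \<Longrightarrow> t' = y" by auto
      have "card (W - U') < card (W - U)"
        using less.prems(2) \<open>finite W\<close> unfolding U'_def by (intro psubset_card_mono) auto
      moreover have "\<forall>x\<in>U'. m' x \<in> L \<and> x \<in> g (m' x) \<and> g (m' x) \<subseteq> insert t' U'"
        using inc t' by (cases "y \<in> U'") auto
      moreover have "\<forall>x\<in>U'. t' \<in> g (m' x) \<longrightarrow> m' x = e"
        using less.prems(2,4) t'(1) unfolding m'_def U'_def by auto
      ultimately show ?thesis
        using less.hyps[OF _ U' t'(1) inj] by blast
    qed
  qed
  show ?thesis
  proof (cases "W = {}")
    case False
    then obtain t where "t \<in> W" by auto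
    then show ?thesis using walk_on[of "{}" t] by auto
  qed auto
qed

section \<open>Choices of pairs with even degrees\<close>

definition even_degrees :: "'e set \<Rightarrow> ('e \<Rightarrow> 'v set) \<Rightarrow> bool" where
  "even_degrees E f \<longleftrightarrow> (\<forall>v. even (card {e \<in> E. v \<in> f e}))"

definition even_choice :: "('v, 'e) pre_hypergraph \<Rightarrow> ('e \<Rightarrow> 'v set) \<Rightarrow> bool" where
  "even_choice H f \<longleftrightarrow>
     (\<forall>e\<in>edges H. f e \<subseteq> ends H e \<and> card (f e) = 2) \<and> even_degrees (edges H) f"

lemma even_degree_of_last_vertex:
  fixes f :: "'e \<Rightarrow> 'v set"
  assumes "finite V" "finite E" "r \<in> V"
    and pairs: "\<And>e. e \<in> E \<Longrightarrow> f e \<subseteq> V \<and> card (f e) = 2"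
    and even_others: "\<And>v. v \<in> V - {r} \<Longrightarrow> even (card {e \<in> E. v \<in> f e})"
  shows "even (card {e \<in> E. r \<in> f e})"
proof -
  have "(\<Sum>v\<in>V. card {e \<in> E. v \<in> f e}) = 2 * card E"
  proof (rule sum_multicount[OF assms(1,2)])
    show "\<forall>e\<in>E. card {v \<in> V. v \<in> f e} = 2"
    proof
      fix e assume "e \<in> E"
      then have "{v \<in> V. v \<in> f e} = f e" using pairs by blast
      then show "card {v \<in> V. v \<in> f e} = 2" using pairs \<open>e \<in> E\<close> by simp
    qed
  qed
  moreover have "even (\<Sum>v\<in>V - {r}. card {e \<in> E. v \<in> f e})"
    using even_others by (intro dvd_sum)
  moreover have "(\<Sum>v\<in>V. card {e \<in> E. v \<in> f e}) =
      card {e \<in> E. r \<in> f e} + (\<Sum>v\<in>V - {r}. card {e \<in> E. v \<in> f e})"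
    by (rule sum.remove[OF assms(1,3)])
  ultimately show ?thesis by presburger
qed

lemma exists_even_choice:
  fixes H :: "('v, 'e) pre_hypergraph"
  assumes "hypergraph H" and unif: "uniform 3 H"
    and cover: "\<And>u v. u \<in> verts H \<Longrightarrow> v \<in> verts H \<Longrightarrow> u \<noteq> v \<Longrightarrow>
           card {e \<in> edges H. u \<in> ends H e \<and> v \<in> ends H e} \<ge> 2"
  shows "\<exists>f. even_choice H f"
proof -
  interpret hypergraph H by fact
  obtain r where r: "r \<in> verts H" using verts_nonempty by auto
  define L where "L = {e \<in> edges H. r \<in> ends H e}"
  have card3: "card (ends H e) = 3" if "e \<in> edges H" for e
    using that unif unfolding uniform_def by auto
  have "\<exists>m. inj_on m (verts H - {r}) \<and>
      (\<forall>x\<in>verts H - {r}. m x \<in> L \<and> x \<in> ends H (m x) - {r})"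
  proof (rule distinct_incident_edges)
    show "finite (verts H - {r})" using finite_verts by simp
    show "card (ends H e - {r}) = 2 \<and> ends H e - {r} \<subseteq> verts H - {r}" if "e \<in> L" for e
      using that card3 ends_subset unfolding L_def by auto
    show "card {e \<in> L. x \<in> ends H e - {r}} \<ge> 2" if "x \<in> verts H - {r}" for x
    proof -
      have "{e \<in> L. x \<in> ends H e - {r}} = {e \<in> edges H. r \<in> ends H e \<and> x \<in> ends H e}"
        using that unfolding L_def by auto
      then show ?thesis using cover[OF r, of x] that by auto
    qed
  qed
  then obtain m where inj: "inj_on m (verts H - {r})"
    and m: "\<And>x. x \<in> verts H - {r} \<Longrightarrow> m x \<in> edges H \<and> r \<in> ends H (m x) \<and> x \<in> ends H (m x)"
    unfolding L_def by blast
  \<comment> \<open>Start by avoiding \<open>r\<close> wherever possible; the element picked by \<open>SOME\<close> is arbitrary.\<close>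
  define f0 where "f0 e = ends H e - {if r \<in> ends H e then r else SOME x. x \<in> ends H e}" for e
  define S where "S = {x \<in> verts H - {r}. odd (card {e \<in> edges H. x \<in> f0 e})}"
  define f where "f e = (if e \<in> m ` S then ends H e - {the_inv_into S m e} else f0 e)" for e
  have injS: "inj_on m S" using inj unfolding S_def by (rule inj_on_subset) auto
  have f_m: "f (m x) = ends H (m x) - {x}" if "x \<in> S" for x
    using that the_inv_into_f_f[OF injS] unfolding f_def by auto
  have f0_m: "f0 (m x) = ends H (m x) - {r}" if "x \<in> S" for x
    using that m[of x] unfolding f0_def S_def by auto
  have pairs: "f e \<subseteq> ends H e \<and> card (f e) = 2" if e: "e \<in> edges H" for e
  proof (cases "e \<in> m ` S")
    case True
    then obtain x where x: "x \<in> S" "e = m x" by auto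
    then have "x \<in> ends H e" using m[of x] unfolding S_def by auto
    then show ?thesis using f_m[OF x(1)] card3[OF e] x by auto
  next
    case False
    have "ends H e \<noteq> {}" using card3[OF e] by auto
    then have "(SOME x. x \<in> ends H e) \<in> ends H e" by (auto intro: someI)
    then show ?thesis using False card3[OF e] unfolding f_def f0_def by auto
  qed
  have even_others: "even (card {e \<in> edges H. v \<in> f e})" if v: "v \<in> verts H - {r}" for v
  proof -
    \<comment> \<open>Replacing \<open>f0\<close> by \<open>f\<close> in the edge \<open>m x\<close> is felt, apart from \<open>r\<close>, by \<open>x\<close> alone.\<close>
    have change: "v \<in> f e \<longleftrightarrow> v \<in> f0 e \<and> \<not> (v \<in> S \<and> e = m v)" for e
    proof (cases "e \<in> m ` S")
      case True
      then obtain x where x: "x \<in> S" "e = m x" by auto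
      have "v \<in> S \<and> e = m v \<longleftrightarrow> v = x" using x injS by (auto dest: inj_onD)
      then show ?thesis using x f_m f0_m v by auto
    next
      case False
      then show ?thesis unfolding f_def by auto
    qed
    show ?thesis
    proof (cases "v \<in> S")
      case True
      have "m v \<in> {e \<in> edges H. v \<in> f0 e}" using True f0_m m[of v] v by auto
      moreover have "{e \<in> edges H. v \<in> f e} = {e \<in> edges H. v \<in> f0 e} - {m v}"
        using change True by auto
      moreover have "odd (card {e \<in> edges H. v \<in> f0 e})" using True unfolding S_def by auto
      ultimately show ?thesis by (simp add: card_Diff_singleton)
    next
      case False
      then have "{e \<in> edges H. v \<in> f e} = {e \<in> edges H. v \<in> f0 e}" using change by auto
      then show ?thesis using False v unfolding S_def by auto
    qed
  qed
  have sub: "f e \<subseteq> verts H" if "e \<in> edges H" for e using pairs ends_subset that by blast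
  have "even (card {e \<in> edges H. r \<in> f e})"
    using even_degree_of_last_vertex[OF finite_verts finite_edges r, of f] sub pairs even_others
    by blast
  moreover have "{e \<in> edges H. v \<in> f e} = {}" if "v \<notin> verts H" for v using sub that by auto
  ultimately have "even (card {e \<in> edges H. v \<in> f e})" for v
    using even_others by (metis Diff_iff card.empty even_zero singletonD)
  then show ?thesis using pairs unfolding even_choice_def even_degrees_def by auto
qed

text \<open>The symmetric difference with \<open>{u, v}\<close> exchanges \<open>u\<close> and \<open>v\<close> in a pair that contains exactly
  one of them.\<close>

definition toggle :: "'v \<Rightarrow> 'v \<Rightarrow> 'v set \<Rightarrow> 'v set" where
  "toggle u v X = (X - {u, v}) \<union> ({u, v} - X)"

lemma toggle_pair: "w \<noteq> u \<Longrightarrow> w \<noteq> v \<Longrightarrow> u \<noteq> v \<Longrightarrow> toggle u v {u, w} = {v, w}"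
  "w \<noteq> u \<Longrightarrow> w \<noteq> v \<Longrightarrow> u \<noteq> v \<Longrightarrow> toggle u v {v, w} = {u, w}"
  unfolding toggle_def by auto

lemma even_card_toggle:
  assumes "finite A" "a \<noteq> b"
  shows "even (card (toggle a b A)) \<longleftrightarrow> even (card A)"
proof -
  have fin: "finite (A - {a, b})" using assms by auto
  have t: "toggle a b A = (A - {a, b}) \<union> ({a, b} - A)" by (simp add: toggle_def)
  have A: "A = (A - {a, b}) \<union> ({a, b} \<inter> A)" by auto
  have "card (toggle a b A) = card (A - {a, b}) + card ({a, b} - A)"
    unfolding t using fin by (intro card_Un_disjoint) auto
  moreover have "card A = card (A - {a, b}) + card ({a, b} \<inter> A)"
    by (subst A, rule card_Un_disjoint) (use fin in auto)
  moreover have "card ({a, b} - A) + card ({a, b} \<inter> A) = 2"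
    using \<open>a \<noteq> b\<close> card_Diff_subset_Int[of "{a, b}" A] card_mono[of "{a, b}" "{a, b} \<inter> A"] by auto
  ultimately show ?thesis by presburger
qed

text \<open>Only the degrees of \<open>u\<close> and \<open>v\<close> are affected, and each of them changes by one at both edges.\<close>

lemma even_choice_exchange:
  assumes f: "even_choice H f" and "finite (edges H)"
    and e: "e1 \<in> edges H" "e2 \<in> edges H" "e1 \<noteq> e2"
    and uv: "{u, v} \<subseteq> ends H e1" "{u, v} \<subseteq> ends H e2"
    and one: "u \<in> f e1 \<longleftrightarrow> v \<notin> f e1" "u \<in> f e2 \<longleftrightarrow> v \<notin> f e2"
  shows "even_choice H (f(e1 := toggle u v (f e1), e2 := toggle u v (f e2)))"
proof -
  let ?g = "f(e1 := toggle u v (f e1), e2 := toggle u v (f e2))"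
  have toggle_card: "card (toggle u v X) = 2" if X: "card X = 2" and X1: "u \<in> X \<longleftrightarrow> v \<notin> X" for X
  proof (cases "u \<in> X")
    case True
    then obtain w where "w \<noteq> u" "X = {u, w}" using card_2_other[OF X] by metis
    then show ?thesis using X1 toggle_pair(1)[of w u v] by (cases "u = v") auto
  next
    case False
    then have "v \<in> X" using X1 by auto
    then obtain w where "w \<noteq> v" "X = {v, w}" using card_2_other[OF X] by metis
    then show ?thesis using X1 False toggle_pair(2)[of w u v] by (cases "u = v") auto
  qed
  have old: "f e \<subseteq> ends H e" "card (f e) = 2" if "e \<in> edges H" for e
    using f that unfolding even_choice_def by auto
  have "?g e \<subseteq> ends H e" if "e \<in> edges H" for e
    using old(1)[OF that] uv unfolding toggle_def by auto
  moreover have "card (?g e) = 2" if "e \<in> edges H" for e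
    using old(2) that toggle_card one by auto
  moreover have "even (card {e \<in> edges H. z \<in> ?g e})" for z
  proof -
    have ev: "even (card {e \<in> edges H. z \<in> f e})"
      using f unfolding even_choice_def even_degrees_def by auto
    show ?thesis
    proof (cases "z \<in> {u, v}")
      case True
      then have "{e \<in> edges H. z \<in> ?g e} = toggle e1 e2 {e \<in> edges H. z \<in> f e}"
        using e unfolding toggle_def by auto
      then show ?thesis using ev even_card_toggle[of _ e1 e2] e(3) assms(2) by simp
    next
      case False
      then have "{e \<in> edges H. z \<in> ?g e} = {e \<in> edges H. z \<in> f e}"
        unfolding toggle_def by auto
      then show ?thesis using ev by simp
    qed
  qed
  ultimately show ?thesis unfolding even_choice_def even_degrees_def by blast
qed

section \<open>Enlarging a connected vertex set\<close>

text \<open>Connected sets are described by the order in which a search adds their vertices: the vertex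
  that comes last is then one that can be removed without destroying connectedness.\<close>

inductive linked :: "'e set \<Rightarrow> ('e \<Rightarrow> 'v set) \<Rightarrow> 'v set \<Rightarrow> bool" for E f where
  single: "linked E f {x}"
| extend: "linked E f S \<Longrightarrow> x \<in> S \<Longrightarrow> y \<notin> S \<Longrightarrow> e \<in> E \<Longrightarrow> f e = {x, y} \<Longrightarrow> linked E f (insert y S)"

lemma linked_cong:
  assumes "linked E f S" and "\<And>e. e \<in> E \<Longrightarrow> f e \<subseteq> S \<Longrightarrow> g e = f e"
  shows "linked E g S"
  using assms
proof (induction rule: linked.induct)
  case (single x)
  show ?case by (rule linked.single)
next
  case (extend S x y e)
  have "linked E g S" using extend.IH extend.prems by blast
  moreover have "g e = {x, y}" using extend.prems[of e] extend.hyps by auto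
  ultimately show ?case using extend.hyps by (intro linked.extend)
qed

lemma linked_crossing_edge:
  assumes "linked E f S" "S \<inter> T \<noteq> {}" "\<not> S \<subseteq> T"
  shows "\<exists>e\<in>E. f e \<inter> T \<noteq> {} \<and> \<not> f e \<subseteq> T"
  using assms
proof (induction rule: linked.induct)
  case (extend S x y e)
  show ?case
  proof (cases "S \<inter> T \<noteq> {} \<and> \<not> S \<subseteq> T")
    case False
    then have "x \<in> T \<longleftrightarrow> y \<notin> T" using extend.hyps extend.prems by auto
    then show ?thesis using extend.hyps by (intro bexI[of _ e]) auto
  qed (use extend.IH in auto)
qed auto

lemma exists_linked_even_choice:
  fixes H :: "('v, 'e) pre_hypergraph"
  assumes "hypergraph H" and unif: "uniform 3 H"
    and cover: "\<And>u v. u \<in> verts H \<Longrightarrow> v \<in> verts H \<Longrightarrow> u \<noteq> v \<Longrightarrow>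
           card {e \<in> edges H. u \<in> ends H e \<and> v \<in> ends H e} \<ge> 2"
    and "edges H \<noteq> {}"
  shows "\<exists>f S. even_choice H f \<and> S \<subseteq> verts H \<and> linked (edges H) f S \<and> (\<forall>e\<in>edges H. f e \<subseteq> S)"
proof -
  interpret hypergraph H by fact
  define cand where "cand = (\<lambda>(f, S). even_choice H f \<and> S \<subseteq> verts H \<and> linked (edges H) f S)"
  obtain f0 where f0: "even_choice H f0"
    using exists_even_choice[OF \<open>hypergraph H\<close> unif cover] by auto
  obtain e0 where e0: "e0 \<in> edges H" using \<open>edges H \<noteq> {}\<close> by auto
  obtain a b where ab: "f0 e0 = {a, b}" "a \<noteq> b"
    using f0 e0 unfolding even_choice_def card_2_iff by blast
  have "linked (edges H) f0 (insert b {a})"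
    by (rule linked.extend[OF linked.single _ _ e0]) (use ab in auto)
  moreover have "insert b {a} \<subseteq> verts H"
    using f0 e0 ends_subset[OF e0] ab unfolding even_choice_def by auto
  ultimately have c0: "cand (f0, {b, a})" using f0 unfolding cand_def by auto
  have "\<exists>p. cand p \<and> (\<forall>q. cand q \<longrightarrow> card (snd q) \<le> card (snd p))"
  proof (rule ex_has_greatest_nat[where k = "(f0, {b, a})"])
    show "\<forall>q. cand q \<longrightarrow> card (snd q) < Suc (card (verts H))"
      unfolding cand_def using card_mono[OF finite_verts] by (auto simp: less_Suc_eq_le)
    show "cand (f0, {b, a})" by fact
  qed
  then obtain f S where fS: "cand (f, S)" and max0: "\<forall>q. cand q \<longrightarrow> card (snd q) \<le> card S"
    by auto
  from fS have f: "even_choice H f" and S: "S \<subseteq> verts H" and lS: "linked (edges H) f S"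
    unfolding cand_def by auto
  have max: "card T \<le> card S" if "even_choice H g" "T \<subseteq> verts H" "linked (edges H) g T" for g T
    using max0 that unfolding cand_def by auto
  have finS: "finite S" using S finite_verts by (rule finite_subset)
  have card_S: "card S \<ge> 2" using max0 c0 ab by fastforce
  have f2: "card (f e) = 2" and f_ends: "f e \<subseteq> ends H e" and f_verts: "f e \<subseteq> verts H"
    if "e \<in> edges H" for e
    using f that ends_subset[OF that] unfolding even_choice_def by auto
  have closed: "f e \<subseteq> S" if e: "e \<in> edges H" and "x \<in> f e" "x \<in> S" for e x
  proof (rule ccontr)
    assume "\<not> f e \<subseteq> S"
    obtain y where y: "f e = {x, y}" using card_2_other[OF f2[OF e] \<open>x \<in> f e\<close>] by metis
    with \<open>\<not> f e \<subseteq> S\<close> \<open>x \<in> S\<close> have "y \<notin> S" by auto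
    have "linked (edges H) f (insert y S)"
      using linked.extend[OF lS \<open>x \<in> S\<close> \<open>y \<notin> S\<close> e y] .
    from max[OF f _ this] show False using S f_verts[OF e] y \<open>y \<notin> S\<close> finS by auto
  qed
  have "\<forall>e\<in>edges H. f e \<subseteq> S"
  proof (rule ccontr)
    assume "\<not> (\<forall>e\<in>edges H. f e \<subseteq> S)"
    then obtain d v where d: "d \<in> edges H" "v \<in> f d" "v \<notin> S" by blast
    obtain y where y: "f d = {v, y}" "y \<noteq> v" using card_2_other[OF f2[OF d(1)] d(2)] by metis
    have "y \<notin> S" using closed[OF d(1), of y] y d by auto
    obtain S' u where S': "S = insert u S'" "u \<notin> S'" "linked (edges H) f S'"
      using lS card_S by (cases rule: linked.cases) auto
    have finS': "finite S'" using S' finS by simp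
    have uv: "u \<noteq> v" "u \<in> verts H" "v \<in> verts H" using S' d S f_verts[OF d(1)] by auto
    have "\<not> card {e \<in> edges H. u \<in> ends H e \<and> v \<in> ends H e} \<le> Suc 0"
      using cover[of u v] uv by auto
    then obtain e1 e2 where e: "e1 \<in> edges H" "e2 \<in> edges H" "e1 \<noteq> e2"
      and uv1: "{u, v} \<subseteq> ends H e1" and uv2: "{u, v} \<subseteq> ends H e2"
      using card_le_Suc0_iff_eq[of "{e \<in> edges H. u \<in> ends H e \<and> v \<in> ends H e}"] finite_edges
      by auto
    \<comment> \<open>By maximality no chosen pair joins \<open>S\<close> to its complement, so the pair is not \<open>{u, v}\<close>, and
      its other vertex lies on the same side of \<open>S\<close>.\<close>
    have one: "(\<exists>w\<in>S'. f e = {u, w}) \<or> (\<exists>w. w \<notin> S \<and> w \<noteq> v \<and> f e = {v, w})"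
      if e: "e \<in> edges H" and "{u, v} \<subseteq> ends H e" for e
    proof -
      have "card (ends H e) = 3" using unif e unfolding uniform_def by auto
      then have "card (ends H e - {u, v}) = 1"
        using that uv(1) by (simp add: card_Diff_subset)
      then obtain w where "ends H e - {u, v} = {w}" using card_1_singletonE by blast
      then have fe: "f e \<subseteq> {u, v, w}" "w \<noteq> u" "w \<noteq> v" using f_ends[OF e] by auto
      have "u \<in> f e \<or> v \<in> f e"
      proof (rule ccontr)
        assume "\<not> (u \<in> f e \<or> v \<in> f e)"
        then have "f e \<subseteq> {w}" using fe by auto
        then have "card (f e) \<le> 1" using card_mono[of "{w}"] by fastforce
        with f2[OF e] show False by simp
      qed
      then show ?thesis
      proof
        assume "u \<in> f e"
        then obtain x where "x \<noteq> u" "f e = {u, x}" using card_2_other[OF f2[OF e]] by metis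
        then show ?thesis using closed[OF e, of u] S' by auto
      next
        assume "v \<in> f e"
        then obtain x where "x \<noteq> v" "f e = {v, x}" using card_2_other[OF f2[OF e]] by metis
        then show ?thesis using closed[OF e, of x] d by auto
      qed
    qed
    \<comment> \<open>One pair inside \<open>S\<close> and one outside: \<open>S\<close> acquires \<open>v\<close>. The vertex \<open>u\<close> is not lost
      because its degree is even, so that a second edge still joins it to \<open>S'\<close>.\<close>
    have mixed: False
      if e: "e1 \<in> edges H" "e2 \<in> edges H" "e1 \<noteq> e2"
        and uv12: "{u, v} \<subseteq> ends H e1" "{u, v} \<subseteq> ends H e2"
        and w1: "w1 \<in> S'" "f e1 = {u, w1}" and w2: "w2 \<notin> S" "w2 \<noteq> v" "f e2 = {v, w2}"
      for e1 e2 w1 w2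
    proof -
      have ne: "w1 \<noteq> u" "w1 \<noteq> v" "w2 \<noteq> u" using w1 w2 S' d by auto
      define g where "g = f(e1 := toggle u v (f e1), e2 := toggle u v (f e2))"
      have "even_choice H g" unfolding g_def
        by (rule even_choice_exchange[OF f finite_edges e uv12]) (use w1 w2 ne uv(1) in auto)
      have g1: "g e1 = {w1, v}"
        using toggle_pair(1)[OF ne(1,2) uv(1)] w1 e(3) unfolding g_def by auto
      have "even (card {e \<in> edges H. u \<in> f e})"
        using f unfolding even_choice_def even_degrees_def by auto
      then have "{e \<in> edges H. u \<in> f e} \<noteq> {e1}" by auto
      then obtain e3 where e3: "e3 \<in> edges H" "u \<in> f e3" "e3 \<noteq> e1" using e w1 by auto
      obtain x where x: "x \<noteq> u" "f e3 = {u, x}" using card_2_other[OF f2[OF e3(1)] e3(2)] by metis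
      have "x \<in> S'" using closed[OF e3(1,2)] x S' by auto
      have "e3 \<noteq> e2" using e3 w2 ne uv by auto
      then have g3: "g e3 = {x, u}" using e3 x unfolding g_def by auto
      have "linked (edges H) g S'"
        by (rule linked_cong[OF S'(3)]) (use w1 w2 S' in \<open>auto simp: g_def\<close>)
      then have "linked (edges H) g S"
        using linked.extend[where f = g, OF _ \<open>x \<in> S'\<close> S'(2) e3(1) g3] S'(1) by simp
      then have "linked (edges H) g (insert v S)"
        using linked.extend[where f = g, OF _ _ d(3) e(1) g1] w1 S'(1) by simp
      from max[OF \<open>even_choice H g\<close> _ this] show False using S uv d finS by simp
    qed
    define g where "g = f(e1 := toggle u v (f e1), e2 := toggle u v (f e2))"
    from one[OF e(1) uv1] show False
    proof
      assume "\<exists>w\<in>S'. f e1 = {u, w}"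
      then obtain w1 where w1: "w1 \<in> S'" "f e1 = {u, w1}" by auto
      from one[OF e(2) uv2] show False
      proof
        \<comment> \<open>Both pairs inside \<open>S\<close>: the set may lose \<open>u\<close>, but it acquires both \<open>v\<close> and \<open>y\<close>.\<close>
        assume "\<exists>w\<in>S'. f e2 = {u, w}"
        then obtain w2 where w2: "w2 \<in> S'" "f e2 = {u, w2}" by auto
        have ne: "w1 \<noteq> u" "w1 \<noteq> v" "w2 \<noteq> u" "w2 \<noteq> v" using w1 w2 S' d by auto
        have "even_choice H g" unfolding g_def
          by (rule even_choice_exchange[OF f finite_edges e uv1 uv2]) (use w1 w2 ne uv(1) in auto)
        have g1: "g e1 = {w1, v}"
          using toggle_pair(1)[OF ne(1,2) uv(1)] w1 e(3) unfolding g_def by auto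
        have "d \<noteq> e1" "d \<noteq> e2" using d w1 w2 S' by auto
        then have gd: "g d = {v, y}" using y unfolding g_def by simp
        have "linked (edges H) g S'"
          by (rule linked_cong[OF S'(3)]) (use w1 w2 S' in \<open>auto simp: g_def\<close>)
        then have "linked (edges H) g (insert v S')"
          using linked.extend[where f = g, OF _ w1(1) _ e(1) g1] d S'(1) by simp
        then have "linked (edges H) g (insert y (insert v S'))"
          using linked.extend[where f = g, OF _ _ _ d(1) gd] y \<open>y \<notin> S\<close> S'(1) by simp
        from max[OF \<open>even_choice H g\<close> _ this] show False
          using S S' uv d y \<open>y \<notin> S\<close> finS' f_verts[OF d(1)] by simp
      next
        assume "\<exists>w. w \<notin> S \<and> w \<noteq> v \<and> f e2 = {v, w}"
        then show False using mixed[OF e uv1 uv2 w1] by blast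
      qed
    next
      assume "\<exists>w. w \<notin> S \<and> w \<noteq> v \<and> f e1 = {v, w}"
      then obtain w1 where w1: "w1 \<notin> S" "w1 \<noteq> v" "f e1 = {v, w1}" by auto
      from one[OF e(2) uv2] show False
      proof
        assume "\<exists>w\<in>S'. f e2 = {u, w}"
        then show False using mixed[OF e(2,1) e(3)[symmetric] uv2 uv1 _ _ w1] by blast
      next
        \<comment> \<open>Both pairs outside \<open>S\<close>: nothing in \<open>S\<close> changes, and a third vertex is attached to \<open>u\<close>.\<close>
        assume "\<exists>w. w \<notin> S \<and> w \<noteq> v \<and> f e2 = {v, w}"
        then obtain w2 where w2: "w2 \<notin> S" "w2 \<noteq> v" "f e2 = {v, w2}" by auto
        have ne: "w1 \<noteq> u" "w2 \<noteq> u" using w1 w2 S' by auto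
        have "even_choice H g" unfolding g_def
          by (rule even_choice_exchange[OF f finite_edges e uv1 uv2]) (use w1 w2 ne uv(1) in auto)
        have g1: "g e1 = {u, w1}"
          using toggle_pair(2)[OF ne(1) w1(2) uv(1)] w1 e(3) unfolding g_def by auto
        have "linked (edges H) g S"
          by (rule linked_cong[OF lS]) (use w1 w2 in \<open>auto simp: g_def\<close>)
        then have "linked (edges H) g (insert w1 S)"
          using linked.extend[where f = g, OF _ _ w1(1) e(1) g1] S'(1) by simp
        from max[OF \<open>even_choice H g\<close> _ this] show False
          using S w1 finS f_verts[OF e(1)] by simp
      qed
    qed
  qed
  then show ?thesis using f S lS by blast
qed

section \<open>Euler's theorem for multigraphs\<close>

fun chain :: "('e \<Rightarrow> 'v set) \<Rightarrow> 'v \<Rightarrow> 'e list \<Rightarrow> 'v \<Rightarrow> bool" where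
  "chain f x [] y \<longleftrightarrow> x = y"
| "chain f x (e # es) y \<longleftrightarrow> (\<exists>z. z \<noteq> x \<and> f e = {x, z} \<and> chain f z es y)"

lemma chain_append: "chain f x (as @ bs) y \<longleftrightarrow> (\<exists>z. chain f x as z \<and> chain f z bs y)"
  by (induction as arbitrary: x) auto

lemma chain_split_at_vertex:
  assumes "chain f x es y" "z \<in> insert x (\<Union>e\<in>set es. f e)"
  shows "\<exists>as bs. es = as @ bs \<and> chain f x as z \<and> chain f z bs y"
  using assms
proof (induction es arbitrary: x)
  case (Cons e es)
  from Cons.prems(1) obtain x' where x': "x' \<noteq> x" "f e = {x, x'}" "chain f x' es y" by auto
  show ?case
  proof (cases "z = x")
    case True
    then show ?thesis using Cons.prems(1) by (intro exI[of _ "[]"] exI[of _ "e # es"]) auto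
  next
    case False
    then have "z \<in> insert x' (\<Union>e\<in>set es. f e)" using Cons.prems(2) x' by auto
    from Cons.IH[OF x'(3) this] obtain as bs where
      "es = as @ bs" "chain f x' as z" "chain f z bs y" by auto
    then show ?thesis using x' by (intro exI[of _ "e # as"] exI[of _ bs]) auto
  qed
qed auto

lemma chain_degree_parity:
  assumes "chain f x es y" "distinct es"
  shows "even (card {e \<in> set es. v \<in> f e}) \<longleftrightarrow> (v = x \<longleftrightarrow> v = y)"
  using assms
proof (induction es arbitrary: x)
  case (Cons e es)
  from Cons.prems(1) obtain z where z: "z \<noteq> x" "f e = {x, z}" "chain f z es y" by auto
  have IH: "even (card {e \<in> set es. v \<in> f e}) \<longleftrightarrow> (v = z \<longleftrightarrow> v = y)"
    using Cons.IH[OF z(3)] Cons.prems(2) by auto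
  have "{e' \<in> set (e # es). v \<in> f e'} =
      (if v \<in> f e then insert e {e' \<in> set es. v \<in> f e'} else {e' \<in> set es. v \<in> f e'})"
    by auto
  then have "card {e' \<in> set (e # es). v \<in> f e'} =
      (if v \<in> f e then Suc (card {e' \<in> set es. v \<in> f e'}) else card {e' \<in> set es. v \<in> f e'})"
    using Cons.prems(2) by simp
  then show ?case using IH z by auto
qed auto

text \<open>A longest trail returns to its start, by parity. If an edge were missing, then by connectedness
  some missing edge would meet the trail; the trail, rotated to start there, could be prolonged.\<close>

lemma multigraph_euler:
  fixes f :: "'e \<Rightarrow> 'v set"
  assumes "finite E" and pairs: "\<And>e. e \<in> E \<Longrightarrow> card (f e) = 2"
    and ev: "even_degrees E f"
    and S: "linked E f S" "\<And>e. e \<in> E \<Longrightarrow> f e \<subseteq> S"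
  shows "\<exists>x es. x \<in> S \<and> chain f x es x \<and> distinct es \<and> set es = E"
proof -
  define cand where
    "cand = (\<lambda>(x, es, y). x \<in> S \<and> chain f x es y \<and> distinct es \<and> set es \<subseteq> E)"
  obtain x0 where "x0 \<in> S" using S(1) by (cases rule: linked.cases) auto
  then have c0: "cand (x0, [], x0)" unfolding cand_def by auto
  have "\<exists>p. cand p \<and> (\<forall>q. cand q \<longrightarrow> length (fst (snd q)) \<le> length (fst (snd p)))"
  proof (rule ex_has_greatest_nat[where k = "(x0, [], x0)"])
    have "length es \<le> card E" if "distinct es" "set es \<subseteq> E" for es
      using that card_mono[OF \<open>finite E\<close>] distinct_card by metis
    then show "\<forall>q. cand q \<longrightarrow> length (fst (snd q)) < Suc (card E)"
      unfolding cand_def by (auto simp: less_Suc_eq_le)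
    show "cand (x0, [], x0)" by fact
  qed
  then obtain x es y where "cand (x, es, y)"
    and max0: "\<forall>q. cand q \<longrightarrow> length (fst (snd q)) \<le> length es"
    by auto
  then have es: "x \<in> S" "chain f x es y" "distinct es" "set es \<subseteq> E" unfolding cand_def by auto
  have no_extension: False
    if ext: "e \<in> E" "e \<notin> set es" "a \<in> f e" "chain f a es' b" "distinct es'" "set es' = set es" for e a es' b
  proof -
    obtain z where z: "z \<noteq> a" "f e = {a, z}"
      using card_2_other[OF pairs[OF ext(1)] ext(3)] by metis
    then have "chain f z (e # es') b" using ext(4) by auto
    moreover have "length es' = length es"
      using ext(5,6) es(3) distinct_card by metis
    moreover have "z \<in> S" using S(2)[OF ext(1)] z by auto
    ultimately have "cand (z, e # es', b)" using ext(1,2,5,6) es(4) unfolding cand_def by auto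
    with max0 have "length (e # es') \<le> length es" by fastforce
    then show False using \<open>length es' = length es\<close> by simp
  qed
  have "x = y"
  proof (rule ccontr)
    assume "x \<noteq> y"
    then have "odd (card {e \<in> set es. x \<in> f e})" using chain_degree_parity[OF es(2,3), of x] by simp
    moreover have "even (card {e \<in> E. x \<in> f e})" using ev unfolding even_degrees_def by auto
    ultimately have "{e \<in> set es. x \<in> f e} \<noteq> {e \<in> E. x \<in> f e}" by metis
    then obtain e where "e \<in> E" "e \<notin> set es" "x \<in> f e" using es(4) by auto
    then show False using no_extension[OF _ _ _ es(2,3)] by blast
  qed
  have "set es = E"
  proof (rule ccontr)
    assume "set es \<noteq> E"
    define T where "T = insert x (\<Union>e\<in>set es. f e)"
    obtain e z where e: "e \<in> E" "e \<notin> set es" "z \<in> f e" "z \<in> T"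
    proof (cases "S \<subseteq> T")
      case True
      obtain e where e: "e \<in> E" "e \<notin> set es" using \<open>set es \<noteq> E\<close> es(4) by auto
      have "f e \<noteq> {}" using pairs[OF e(1)] by auto
      then show thesis using that e S(2)[OF e(1)] True by blast
    next
      case False
      then obtain e where "e \<in> E" "f e \<inter> T \<noteq> {}" "\<not> f e \<subseteq> T"
        using linked_crossing_edge[OF S(1), of T] es(1) unfolding T_def by auto
      moreover from this have "e \<notin> set es" unfolding T_def by auto
      ultimately show thesis using that by blast
    qed
    obtain as bs where ab: "es = as @ bs" "chain f x as z" "chain f z bs y"
      using chain_split_at_vertex[OF es(2)] e(4) unfolding T_def by blast
    then have "chain f z (bs @ as) z" using \<open>x = y\<close> unfolding chain_append by auto
    then show False using no_extension[OF e(1-3), of "bs @ as" z] ab(1) es(3) by auto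
  qed
  then show ?thesis using es \<open>x = y\<close> by auto
qed

section \<open>Euler tours of hypergraphs\<close>

lemma chain_imp_walk:
  assumes "chain f x es y" "set es \<subseteq> edges H" "x \<in> verts H"
    and "\<And>e. e \<in> edges H \<Longrightarrow> f e \<subseteq> ends H e \<and> ends H e \<subseteq> verts H"
  shows "\<exists>vs. walk H vs es \<and> hd vs = x \<and> last vs = y"
  using assms(1-3)
proof (induction es arbitrary: x)
  case Nil
  then show ?case by (intro exI[of _ "[x]"]) (auto simp: walk_def)
next
  case (Cons e es)
  then obtain z where z: "z \<noteq> x" "f e = {x, z}" "chain f z es y" by auto
  have e: "x \<in> ends H e" "z \<in> ends H e" "z \<in> verts H" using assms(4)[of e] Cons.prems z by auto
  then obtain vs where vs: "walk H vs es" "hd vs = z" "last vs = y"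
    using Cons.IH[OF z(3)] Cons.prems by auto
  have ne: "vs \<noteq> []" using vs(1) unfolding walk_def by auto
  then have "vs ! 0 = z" using vs(2) by (simp add: hd_conv_nth)
  then have "walk H (x # vs) (e # es)"
    using vs(1) Cons.prems e z(1) unfolding walk_def by (auto simp: nth_Cons split: nat.split)
  then show ?case using vs ne by (intro exI[of _ "x # vs"]) auto
qed

theorem theorem4p2p1:
  fixes H :: "('v, 'e) pre_hypergraph"
  assumes "hypergraph H"
    and "uniform 3 H"
    and "\<And>u v. u \<in> verts H \<Longrightarrow> v \<in> verts H \<Longrightarrow> u \<noteq> v \<Longrightarrow>
           card {e \<in> edges H. u \<in> ends H e \<and> v \<in> ends H e} \<ge> 2"
  shows "eulerian H"
proof -
  interpret hypergraph H by fact
  show ?thesis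
  proof (cases "edges H = {}")
    case True
    obtain x where "x \<in> verts H" using verts_nonempty by auto
    then have "euler_tour H [x] []"
      using True unfolding euler_tour_def closed_walk_def strict_trail_def walk_def by auto
    then show ?thesis unfolding eulerian_def by blast
  next
    case False
    obtain f S where f: "even_choice H f" and S: "S \<subseteq> verts H" "linked (edges H) f S"
      and inS: "\<forall>e\<in>edges H. f e \<subseteq> S"
      using exists_linked_even_choice[OF assms False] by blast
    obtain x es where es: "x \<in> S" "chain f x es x" "distinct es" "set es = edges H"
      using multigraph_euler[OF finite_edges _ _ S(2), of] f inS unfolding even_choice_def by blast
    obtain vs where "walk H vs es" "hd vs = x" "last vs = x"
      using chain_imp_walk[OF es(2), of H] es S(1) f ends_subset unfolding even_choice_def by blast
    then have "euler_tour H vs es"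
      using es unfolding euler_tour_def closed_walk_def strict_trail_def by auto
    then show ?thesis unfolding eulerian_def by blast
  qed
qed

end
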